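(* Let $a<b$, let $0<\alpha,\beta\le 1$ with $\alpha+\beta>1$, and let $\psi\in C^1[a,b]$ with $\psi'(t)>0$ for all $t\in[a,b]$. Suppose that: (1) there exists a positive function $\kappa_3:(a,b)\to\mathbb{R}_+$ such that $|f(t,x)-f(t,y)|\le\kappa_3(t)|x-y|$ for any $t\in(a,b)$ and $x,y\in\mathbb{R}$; (2) there exists $\kappa_4\in(0,1)$ such that $|\mathcal{G}(x)-\mathcal{G}(y)|\le\kappa_4|x-y|$ for all $x,y\in\mathbb{R}$. Suppose further that $\psi'(\cdot)\kappa_3(\cdot)\in L^1(a,b)$ and $\psi'(\cdot)f(\cdot,0)\in L^1(a,b)$. If $$\kappa_4+G_{\max}\,\|\psi'(\cdot)\kappa_3(\cdot)\|_{L^1(a,b)}<1,$$ where $$G_{\max}=\frac{1}{\Gamma(\alpha+\beta)}(\psi(b)-\psi(a))^{\alpha+\beta-1}\max\left\{\beta^\beta(\alpha+\beta-1)^{\alpha+\beta-1},\ \frac{\beta(\alpha+\beta-1)^{\frac{\alpha+\beta-1}{\beta}}}{(\alpha+2\beta-1)^{\frac{\alpha+2\beta-1}{\beta}}}\right\},$$ then the problem $$\left({}^C D_{a+}^{\alpha,\psi}\,{}^C D_{a+}^{\beta,\psi}x\right)(t)+f(t,x(t))=0,\quad a<t<b,\qquad x(a)=0,\quad x(b)=\mathcal{G}(x)$$ has a unique mild solution.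
   Context: $\mathbb{R}_+$ is the set of non-negative reals; $\|x\|=\sup_{a\le t\le b}|x(t)|$ for $x\in C[a,b]$; $\Gamma$ is the Gamma function. $f$ is a real-valued function on $(a,b)\times\mathbb{R}$. In the boundary condition $\mathcal{G}$ is applied to the unknown function $x\in C[a,b]$ and $\mathcal{G}(x)$ is a real number; for functions $x,y\in C[a,b]$ hypothesis (2) is used in the form $|\mathcal{G}(x)-\mathcal{G}(y)|\le\kappa_4\|x-y\|$. ${}^C D_{a+}^{\gamma,\psi}$ denotes the left $\psi$-Caputo fractional derivative, ${}^C D_{a+}^{\gamma,\psi}y=I_{a+}^{1-\gamma,\psi}(y'/\psi')$ for $0<\gamma\le1$, where $I_{a+}^{\gamma,\psi}y(t)=\frac{1}{\Gamma(\gamma)}\int_a^t\psi'(\tau)(\psi(t)-\psi(\tau))^{\gamma-1}y(\tau)\,d\tau$ for $\gamma>0$ and $I_{a+}^{0,\psi}$ is the identity. A mild solution of the problem is a function $x\in C[a,b]$ satisfying $$x(t)=\left(\frac{\psi(t)-\psi(a)}{\psi(b)-\psi(a)}\right)^{\beta}\mathcal{G}(x)+\int_a^b G(\tau,t)\,\psi'(\tau)\,f(\tau,x(\tau))\,d\tau,$$ where $$G(\tau,t)=\begin{cases} C(\psi(t)-\psi(a))^\beta(\psi(b)-\psi(\tau))^{\alpha+\beta-1}-D(\psi(t)-\psi(\tau))^{\alpha+\beta-1}, & a\le\tau\le t\le b,\\ C(\psi(t)-\psi(a))^\beta(\psi(b)-\psi(\tau))^{\alpha+\beta-1}, & a\le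 t\le\tau\le b,\end{cases}$$ with $C=\frac{1}{\Gamma(\alpha+\beta)(\psi(b)-\psi(a))^{\beta}}$ and $D=\frac{1}{\Gamma(\alpha+\beta)}$.
   Formalization: The first entry of the maximum in G_max is divided by (α+2β−1)^(α+2β−1), since the printed constant fails when α+2β<2; and f(·,y) is assumed Lebesgue measurable on (a,b) for every real y, without which mild solutions may not exist. *)

theory Defs
  imports "HOL-Analysis.Analysis"
begin

(* The space C[a,b].  Its members are genuine functions on [a,b]: outside the interval they take
   the dummy value "undefined", so equality in HOL is equality on [a,b]. *)
definition C_space :: "real \<Rightarrow> real \<Rightarrow> (real \<Rightarrow> real) set" where
  "C_space a b = {x \<in> extensional {a..b}. continuous_on {a..b} x}"

definition sup_norm :: "real \<Rightarrow> real \<Rightarrow> (real \<Rightarrow> real) \<Rightarrow> real" where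
  "sup_norm a b x = (SUP t\<in>{a..b}. \<bar>x t\<bar>)"

definition green ::
    "real \<Rightarrow> real \<Rightarrow> real \<Rightarrow> real \<Rightarrow> (real \<Rightarrow> real) \<Rightarrow> real \<Rightarrow> real \<Rightarrow> real" where
  "green a b \<alpha> \<beta> \<psi> \<tau> t =
     (let C = 1 / (Gamma (\<alpha> + \<beta>) * (\<psi> b - \<psi> a) powr \<beta>);
          D = 1 / Gamma (\<alpha> + \<beta>)
      in if \<tau> \<le> t
         then C * (\<psi> t - \<psi> a) powr \<beta> * (\<psi> b - \<psi> \<tau>) powr (\<alpha> + \<beta> - 1)
                - D * (\<psi> t - \<psi> \<tau>) powr (\<alpha> + \<beta> - 1)
         else C * (\<psi> t - \<psi> a) powr \<beta> * (\<psi> b - \<psi> \<tau>) powr (\<alpha> + \<beta> - 1))"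

(* A bound for |green|.  With c = \<alpha> + \<beta> - 1, the first entry of the maximum is the maximum of
   u^\<beta> (1 - u)^c over 0 \<le> u \<le> 1 (the diagonal of the Green function) and the second one is the
   maximum of u^c (1 - u^\<beta>).  The source prints the first entry without its denominator
   (\<alpha> + 2 \<beta> - 1)^(\<alpha> + 2 \<beta> - 1).  That expression is no longer a bound for |green| when
   \<alpha> + 2 \<beta> < 2, and uniqueness then fails, e.g. for \<alpha> = 1, \<beta> = 1/4; so the denominator is
   restored here.  For \<alpha> + 2 \<beta> \<ge> 2 the value below is at most the printed one. *)
definition G_max :: "real \<Rightarrow> real \<Rightarrow> real \<Rightarrow> real \<Rightarrow> (real \<Rightarrow> real) \<Rightarrow> real" where
  "G_max a b \<alpha> \<beta> \<psi> =
     1 / Gamma (\<alpha> + \<beta>) * (\<psi> b - \<psi> a) powr (\<alpha> + \<beta> - 1) *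
     max (\<beta> powr \<beta> * (\<alpha> + \<beta> - 1) powr (\<alpha> + \<beta> - 1)
            / (\<alpha> + 2 * \<beta> - 1) powr (\<alpha> + 2 * \<beta> - 1))
         (\<beta> * (\<alpha> + \<beta> - 1) powr ((\<alpha> + \<beta> - 1) / \<beta>)
            / (\<alpha> + 2 * \<beta> - 1) powr ((\<alpha> + 2 * \<beta> - 1) / \<beta>))"

(* Mild solutions of the boundary value problem
     (D^\<alpha> D^\<beta> x)(t) + f(t, x(t)) = 0  for a < t < b,    x(a) = 0,    x(b) = \<G>(x),
   where D^\<alpha>, D^\<beta> are the left \<psi>-Caputo derivatives and \<psi>' is the derivative of \<psi>.  By
   definition these are the continuous solutions of the integral equation below, so the
   fractional derivatives themselves do not occur.  The integrability conjunct says that the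
   integral exists; it excludes the library's default value 0 for undefined integrals. *)
definition mild_solution ::
    "real \<Rightarrow> real \<Rightarrow> real \<Rightarrow> real \<Rightarrow> (real \<Rightarrow> real) \<Rightarrow> (real \<Rightarrow> real) \<Rightarrow> (real \<Rightarrow> real \<Rightarrow> real)
      \<Rightarrow> ((real \<Rightarrow> real) \<Rightarrow> real) \<Rightarrow> (real \<Rightarrow> real) \<Rightarrow> bool" where
  "mild_solution a b \<alpha> \<beta> \<psi> \<psi>' f \<G> x \<longleftrightarrow>
     x \<in> C_space a b \<and>
     (\<forall>t\<in>{a..b}.
        set_integrable lebesgue {a<..<b} (\<lambda>\<tau>. green a b \<alpha> \<beta> \<psi> \<tau> t * \<psi>' \<tau> * f \<tau> (x \<tau>)) \<and>
        x t = ((\<psi> t - \<psi> a) / (\<psi> b - \<psi> a)) powr \<beta> * \<G> x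
              + (LINT \<tau>:{a<..<b}|lebesgue. green a b \<alpha> \<beta> \<psi> \<tau> t * \<psi>' \<tau> * f \<tau> (x \<tau>)))"

end

theory Submission
  imports Defs
begin

text \<open>
  The mild solutions are the fixed points of the integral operator T on C[a,b].  In the normalised
  variables u = (\<psi> t - \<psi> a) / (\<psi> b - \<psi> a) and v = (\<psi> \<tau> - \<psi> a) / (\<psi> b - \<psi> a), with
  c = \<alpha> + \<beta> - 1 in (0,1], the Green function is a multiple of u^\<beta> (1 - v)^c - (u - v)_+^c.
  Subadditivity of x^c bounds it from above by u^\<beta> (1 - u)^c; from below it is at least
  u^(c + \<beta>) - u^c, because (u - v) \<le> u (1 - v).  Both bounds have the form
  w^p (1 - w)^q up to sign, with w = u or w = u^\<beta>, and weighted AM-GM gives their maxima, which are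
  the two entries of G_max.  Hence T is a contraction with constant
  \<kappa>4 + G_max * (L1 norm of \<psi>' \<kappa>3), and Banach's theorem applies.
\<close>

section \<open>Power inequalities and the normalised Green function\<close>

lemma powr_add_le:
  fixes x y c :: real
  assumes "0 \<le> x" "0 \<le> y" "0 < c" "c \<le> 1"
  shows "(x + y) powr c \<le> x powr c + y powr c"
proof (cases "x + y = 0")
  case True
  then show ?thesis using assms by simp
next
  case False
  define s where "s = x + y"
  have s: "s > 0" using False assms s_def by simp
  \<comment> \<open>The concave graph of z^c lies above its chord on [0, s]; the chord values at x
    and y add up to s^c.\<close>
  have *: "z / s * s powr c \<le> z powr c" if "0 \<le> z" "z \<le> s" for z
  proof -
    have "z / s = (z / s) powr 1" using that s by simp
    also have "\<dots> \<le> (z / s) powr c"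
      using that s assms by (intro powr_mono') auto
    finally have "z / s * s powr c \<le> (z / s) powr c * s powr c"
      by (intro mult_right_mono) auto
    also have "\<dots> = z powr c" using that s by (simp add: powr_divide)
    finally show ?thesis .
  qed
  have "s powr c = x / s * s powr c + y / s * s powr c"
    using s by (simp add: s_def flip: add_divide_distrib distrib_right)
  also have "\<dots> \<le> x powr c + y powr c"
    using *[of x] *[of y] assms s_def by (intro add_mono) auto
  finally show ?thesis by (simp add: s_def)
qed

text \<open>Weighted AM-GM. The tangent inequality ln z <= z - 1 is applied to u and 1 - u divided
  by their values p / (p + q) and q / (p + q) at the maximiser; the linear terms then cancel, and
  the bound is attained.\<close>

lemma powr_mult_powr_le:
  fixes u p q :: real
  assumes "0 \<le> u" "u \<le> 1" "0 < p" "0 < q"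
  shows "u powr p * (1 - u) powr q \<le> p powr p * q powr q / (p + q) powr (p + q)"
\<comment> \<open>Logarithms need an interior point; at either end one factor is a power of 0 and
  vanishes.\<close>
proof (cases "u = 0 \<or> u = 1")
  case True
  then show ?thesis using assms by auto
next
  case False
  then have u: "0 < u" "0 < 1 - u" using assms by auto
  define r where "r = p + q"
  have r: "r > 0" using assms r_def by simp
  have "p * ln (u * r / p) \<le> p * (u * r / p - 1)"
    using u r assms by (intro mult_left_mono ln_le_minus_one) auto
  moreover have "q * ln ((1 - u) * r / q) \<le> q * ((1 - u) * r / q - 1)"
    using u r assms by (intro mult_left_mono ln_le_minus_one) auto
  moreover have "p * (u * r / p - 1) + q * ((1 - u) * r / q - 1) = 0"
    using assms by (simp add: field_simps r_def)
  ultimately have "p * ln (u * r / p) + q * ln ((1 - u) * r / q) \<le> 0" by linarith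
  then have "p * ln u + q * ln (1 - u) \<le> p * ln p + q * ln q - r * ln r"
    using u r assms by (simp add: ln_mult_pos ln_divide_pos) (simp add: r_def algebra_simps)
  then have "exp (p * ln u + q * ln (1 - u)) \<le> exp (p * ln p + q * ln q - r * ln r)"
    by simp
  then show ?thesis
    using u r assms by (simp add: powr_def exp_add exp_diff r_def)
qed

text \<open>The maximum is needed because powr does not vanish at negative bases; at 0 it does.\<close>

definition unit_green :: "real \<Rightarrow> real \<Rightarrow> real \<Rightarrow> real \<Rightarrow> real" where
  "unit_green \<beta> c v u = u powr \<beta> * (1 - v) powr c - (max 0 (u - v)) powr c"

lemma abs_unit_green_le:
  assumes "0 \<le> u" "u \<le> 1" "0 \<le> v" "v \<le> 1" "0 < \<beta>" "0 < c" "c \<le> 1"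
  shows "\<bar>unit_green \<beta> c v u\<bar>
    \<le> max (\<beta> powr \<beta> * c powr c / (c + \<beta>) powr (c + \<beta>))
          (\<beta> * c powr (c / \<beta>) / (c + \<beta>) powr ((c + \<beta>) / \<beta>))" (is "_ \<le> max ?A ?B")
proof -
  have A: "u powr \<beta> * (1 - u) powr c \<le> ?A"
    using powr_mult_powr_le[of u \<beta> c] assms by (simp add: add.commute)
  have B: "u powr c * (1 - u powr \<beta>) \<le> ?B"
  proof -
    \<comment> \<open>With w = u^\<beta> this is w^p (1 - w)^q for p = c / \<beta> and q = 1; the
      remaining equalities only bring the resulting maximum into the form of
      \<open>?B\<close>.\<close>
    have "u powr c * (1 - u powr \<beta>) = (u powr \<beta>) powr (c / \<beta>) * (1 - u powr \<beta>) powr 1"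
      using assms by (simp add: powr_powr powr_le1)
    also have "\<dots> \<le> (c / \<beta>) powr (c / \<beta>) * 1 powr 1 / (c / \<beta> + 1) powr (c / \<beta> + 1)"
      using assms by (intro powr_mult_powr_le) (auto simp: powr_le1)
    also have "c / \<beta> + 1 = (c + \<beta>) / \<beta>" using assms by (simp add: field_simps)
    also have "(c / \<beta>) powr (c / \<beta>) * 1 powr 1 / ((c + \<beta>) / \<beta>) powr ((c + \<beta>) / \<beta>)
       = c powr (c / \<beta>) * (\<beta> powr ((c + \<beta>) / \<beta>) / \<beta> powr (c / \<beta>)) / (c + \<beta>) powr ((c + \<beta>) / \<beta>)"
      using assms by (simp add: powr_divide)
    also have "\<beta> powr ((c + \<beta>) / \<beta>) / \<beta> powr (c / \<beta>) = \<beta>"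
      using assms by (simp add: add_divide_distrib flip: powr_diff)
    finally show ?thesis by (simp add: mult.commute)
  qed
  show ?thesis
  proof (cases "v \<le> u")
    case False
    have "(1 - v) powr c \<le> (1 - u) powr c"
      using False assms by (intro powr_mono2) auto
    then have "u powr \<beta> * (1 - v) powr c \<le> ?A"
      using A by (smt (verit) mult_left_mono powr_ge_zero)
    then show ?thesis using False by (simp add: unit_green_def abs_mult)
  next
    case True
    \<comment> \<open>Subadditivity for the splitting 1 - v = (1 - u) + (u - v).\<close>
    have "u powr \<beta> * ((1 - v) powr c - (1 - u) powr c) \<le> u powr \<beta> * (u - v) powr c"
      using powr_add_le[of "1 - u" "u - v" c] True assms by (intro mult_left_mono) auto
    also have "\<dots> \<le> 1 * (u - v) powr c"
      using assms by (intro mult_right_mono) (auto simp: powr_le1)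
    finally have upper: "u powr \<beta> * (1 - v) powr c - (u - v) powr c \<le> ?A"
      using A by (simp add: algebra_simps)
    have "u * v \<le> v" using assms mult_right_mono[of u 1 v] by simp
    then have "(u - v) powr c \<le> (u * (1 - v)) powr c"
      using True assms by (intro powr_mono2) (auto simp: algebra_simps)
    also have "\<dots> = (1 - v) powr c * u powr c" using assms by (simp add: powr_mult)
    finally have "(u - v) powr c - u powr \<beta> * (1 - v) powr c
        \<le> (1 - v) powr c * (u powr c - u powr \<beta>)"
      by (simp add: algebra_simps)
    \<comment> \<open>The difference u^c - u^\<beta> is negative for 0 < u < 1 when \<beta> < c, so
      the factor (1 - v)^c cannot be replaced by 1 yet. Lowering u^\<beta> to u^(c + \<beta>) makes
      the difference nonnegative and gives it the shape bounded by \<open>?B\<close>.\<close>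
    also have "\<dots> \<le> (1 - v) powr c * (u powr c - u powr (c + \<beta>))"
      using assms by (intro mult_left_mono diff_left_mono powr_mono') auto
    also have "\<dots> \<le> 1 * (u powr c - u powr (c + \<beta>))"
      using assms by (intro mult_right_mono) (auto simp: powr_le1 intro!: powr_mono')
    also have "\<dots> \<le> ?B"
      using B by (simp add: powr_add algebra_simps)
    finally have lower: "(u - v) powr c - u powr \<beta> * (1 - v) powr c \<le> ?B" .
    show ?thesis using upper lower True
      by (intro abs_leI) (simp_all add: unit_green_def max.coboundedI1 max.coboundedI2)
  qed
qed

text \<open>Both arguments are functions, so that continuity in t for fixed \<tau> and in \<tau> for
  fixed t are instances. Positive exponents keep the powers continuous where a base reaches 0, in
  particular across the diagonal.\<close>

lemma continuous_on_unit_green: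
  assumes "0 < \<beta>" "0 < c" "continuous_on A v" "continuous_on A u"
    and "\<And>t. t \<in> A \<Longrightarrow> v t \<le> 1" "\<And>t. t \<in> A \<Longrightarrow> 0 \<le> u t"
  shows "continuous_on A (\<lambda>t. unit_green \<beta> c (v t) (u t))"
  unfolding unit_green_def
  using assms by (intro continuous_intros continuous_on_powr') auto

section \<open>Measurability of superpositions and integrals with a bounded kernel\<close>

lemma borel_measurable_Caratheodory:
  fixes f :: "'a \<Rightarrow> real \<Rightarrow> real"
  assumes meas: "\<And>y. (\<lambda>t. f t y) \<in> borel_measurable M"
    and cont: "\<And>t. t \<in> space M \<Longrightarrow> continuous_on UNIV (f t)"
    and x: "x \<in> borel_measurable M"
  shows "(\<lambda>t. f t (x t)) \<in> borel_measurable M"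
proof -
  \<comment> \<open>A simple function takes finitely many values, so measurability of f for each
    fixed y settles that case; continuity in the second argument carries it to the limit.\<close>
  obtain s where s: "\<And>i. simple_function M (s i)"
    and lim: "\<And>t. t \<in> space M \<Longrightarrow> (\<lambda>i. s i t) \<longlonglongrightarrow> x t"
    using borel_measurable_implies_sequence_metric[OF x, of 0] by metis
  show ?thesis
  proof (rule borel_measurable_LIMSEQ_metric)
    fix i
    have "s i \<in> measurable M (count_space (s i ` space M))"
      using s[of i] measurable_simple_function by (auto simp: simple_function_def measurable_count_space_eq2)
    moreover have "countable (s i ` space M)"
      using s[of i] by (simp add: simple_function_def countable_finite)
    ultimately show "(\<lambda>t. f t (s i t)) \<in> borel_measurable M"
      using measurable_compose_countable'[where f = "\<lambda>y t. f t y", OF meas] by blast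
  next
    fix t assume t: "t \<in> space M"
    show "(\<lambda>i. f t (s i t)) \<longlonglongrightarrow> f t (x t)"
      by (rule continuous_on_tendsto_compose[OF cont[OF t] lim[OF t]]) auto
  qed
qed

text \<open>The data are controlled only on S, so f and x are both multiplied by the indicator of S.
  The cut-off family is continuous in y for every t, being zero off S, and nothing changes on
  S.\<close>

lemma set_borel_measurable_Caratheodory:
  fixes f :: "'a \<Rightarrow> real \<Rightarrow> real"
  assumes meas: "\<And>y. set_borel_measurable M S (\<lambda>t. f t y)"
    and cont: "\<And>t. t \<in> S \<Longrightarrow> continuous_on UNIV (f t)"
    and x: "set_borel_measurable M S x"
  shows "set_borel_measurable M S (\<lambda>t. f t (x t))"
proof -
  have "continuous_on UNIV (\<lambda>y. indicat_real S t * f t y)" for t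
    using cont[of t] by (cases "t \<in> S") auto
  then have "(\<lambda>t. indicat_real S t * f t (indicat_real S t * x t)) \<in> borel_measurable M"
    using borel_measurable_Caratheodory[where f = "\<lambda>t y. indicat_real S t * f t y"
        and x = "\<lambda>t. indicat_real S t * x t" and M = M] meas x
    by (simp add: set_borel_measurable_def)
  also have "(\<lambda>t. indicat_real S t * f t (indicat_real S t * x t))
      = (\<lambda>t. indicat_real S t *\<^sub>R f t (x t))"
    by (auto simp: indicator_def)
  finally show ?thesis by (simp add: set_borel_measurable_def)
qed

lemma set_borel_measurable_mult:
  fixes k h :: "'a \<Rightarrow> real"
  assumes "set_borel_measurable M S k" "set_borel_measurable M S h"
  shows "set_borel_measurable M S (\<lambda>\<tau>. k \<tau> * h \<tau>)"
proof -
  have "(\<lambda>\<tau>. (indicat_real S \<tau> *\<^sub>R k \<tau>) * (indicat_real S \<tau> *\<^sub>R h \<tau>)) \<in> borel_measurable M"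
    using assms unfolding set_borel_measurable_def by (rule borel_measurable_times)
  also have "(\<lambda>\<tau>. (indicat_real S \<tau> *\<^sub>R k \<tau>) * (indicat_real S \<tau> *\<^sub>R h \<tau>))
      = (\<lambda>\<tau>. indicat_real S \<tau> *\<^sub>R (k \<tau> * h \<tau>))"
    by (auto simp: indicator_def)
  finally show ?thesis by (simp add: set_borel_measurable_def)
qed

lemma set_integrable_bounded_mult:
  fixes k h :: "'a \<Rightarrow> real"
  assumes h: "set_integrable M S h"
    and k: "set_borel_measurable M S k" "\<And>\<tau>. \<tau> \<in> S \<Longrightarrow> \<bar>k \<tau>\<bar> \<le> B"
  shows "set_integrable M S (\<lambda>\<tau>. k \<tau> * h \<tau>)"
proof (rule set_integrable_bound)
  show "set_integrable M S (\<lambda>\<tau>. B * h \<tau>)" using h by simp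
  show "set_borel_measurable M S (\<lambda>\<tau>. k \<tau> * h \<tau>)"
    using h k(1) by (intro set_borel_measurable_mult)
      (auto simp: set_integrable_def set_borel_measurable_def)
  have "\<bar>k \<tau> * h \<tau>\<bar> \<le> \<bar>B * h \<tau>\<bar>" if "\<tau> \<in> S" for \<tau>
    using k(2)[OF that] by (auto simp: abs_mult intro!: mult_right_mono)
  then show "AE \<tau> in M. \<tau> \<in> S \<longrightarrow> norm (k \<tau> * h \<tau>) \<le> norm (B * h \<tau>)" by simp
qed

text \<open>Dominated convergence with majorant \<open>B * \<bar>h \<tau>\<bar>\<close>, which does
  not depend on t; sequences suffice because the parameter space is first countable.\<close>

lemma continuous_on_set_integral_kernel:
  fixes k :: "'a \<Rightarrow> 'b::{first_countable_topology, t2_space} \<Rightarrow> real" and h :: "'a \<Rightarrow> real"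
  assumes h: "set_integrable M S h"
    and meas: "\<And>t. t \<in> T \<Longrightarrow> set_borel_measurable M S (\<lambda>\<tau>. k \<tau> t)"
    and bound: "\<And>\<tau> t. \<tau> \<in> S \<Longrightarrow> t \<in> T \<Longrightarrow> \<bar>k \<tau> t\<bar> \<le> B"
    and cont: "\<And>\<tau>. \<tau> \<in> S \<Longrightarrow> continuous_on T (k \<tau>)"
  shows "continuous_on T (\<lambda>t. LINT \<tau>:S|M. k \<tau> t * h \<tau>)"
proof (rule continuous_on_sequentiallyI)
  fix u t assume u: "\<forall>n. u n \<in> T" and t: "t \<in> T" and lim: "u \<longlonglongrightarrow> t"
  have int: "set_integrable M S (\<lambda>\<tau>. k \<tau> t * h \<tau>)" if "t \<in> T" for t
    using that by (intro set_integrable_bounded_mult[OF h, where B = B] meas bound)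
  show "(\<lambda>n. LINT \<tau>:S|M. k \<tau> (u n) * h \<tau>) \<longlonglongrightarrow> (LINT \<tau>:S|M. k \<tau> t * h \<tau>)"
    unfolding set_lebesgue_integral_def
  proof (rule integral_dominated_convergence)
    show "(\<lambda>\<tau>. indicat_real S \<tau> *\<^sub>R (k \<tau> t * h \<tau>)) \<in> borel_measurable M"
      using int[OF t] unfolding set_integrable_def by auto
    show "(\<lambda>\<tau>. indicat_real S \<tau> *\<^sub>R (k \<tau> (u n) * h \<tau>)) \<in> borel_measurable M" for n
      using int[of "u n"] u unfolding set_integrable_def by auto
    show "integrable M (\<lambda>\<tau>. indicat_real S \<tau> *\<^sub>R (B * \<bar>h \<tau>\<bar>))"
      using set_integrable_mult_right[of B, OF set_integrable_abs[OF h]] unfolding set_integrable_def by auto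
    show "AE \<tau> in M. (\<lambda>n. indicat_real S \<tau> *\<^sub>R (k \<tau> (u n) * h \<tau>))
        \<longlonglongrightarrow> indicat_real S \<tau> *\<^sub>R (k \<tau> t * h \<tau>)"
    proof (rule AE_I2)
      fix \<tau>
      have "(\<lambda>n. k \<tau> (u n)) \<longlonglongrightarrow> k \<tau> t" if "\<tau> \<in> S"
        using continuous_on_tendsto_compose[OF cont[OF that] lim t] u by auto
      then show "(\<lambda>n. indicat_real S \<tau> *\<^sub>R (k \<tau> (u n) * h \<tau>))
          \<longlonglongrightarrow> indicat_real S \<tau> *\<^sub>R (k \<tau> t * h \<tau>)"
        by (cases "\<tau> \<in> S") (auto intro!: tendsto_intros)
    qed
    show "AE \<tau> in M. norm (indicat_real S \<tau> *\<^sub>R (k \<tau> (u n) * h \<tau>))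
        \<le> indicat_real S \<tau> *\<^sub>R (B * \<bar>h \<tau>\<bar>)" for n
      using bound u by (auto simp: indicator_def abs_mult intro!: mult_right_mono)
  qed
qed

section \<open>The complete metric space C[a,b]\<close>

lemma abs_le_sup_norm:
  assumes "continuous_on {a..b} x" "t \<in> {a..b}"
  shows "\<bar>x t\<bar> \<le> sup_norm a b x"
proof -
  have "compact ((\<lambda>t. \<bar>x t\<bar>) ` {a..b})"
    using assms(1) by (intro compact_continuous_image continuous_intros) auto
  then have "bdd_above ((\<lambda>t. \<bar>x t\<bar>) ` {a..b})"
    by (intro bounded_imp_bdd_above compact_imp_bounded)
  then show ?thesis
    unfolding sup_norm_def using assms(2) by (intro cSUP_upper)
qed

lemma restrict_in_C_space:
  assumes "continuous_on {a..b} x"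
  shows "restrict x {a..b} \<in> C_space a b"
  using assms continuous_on_cong[of "{a..b}" "{a..b}" "restrict x {a..b}" x]
  by (simp add: C_space_def)

text \<open>Banach's theorem in \<open>cfunspace\<close>, the space of bounded continuous functions
  with the uniform distance. Compactness of [a,b] makes boundedness automatic, so the carrier is
  exactly \<open>C_space a b\<close>, and completeness is inherited from the reals.\<close>

lemma C_space_contraction:
  assumes "a \<le> b" and T: "T \<in> C_space a b \<rightarrow> C_space a b" and k: "k < 1"
    and con: "\<And>x y t. \<lbrakk>x \<in> C_space a b; y \<in> C_space a b; t \<in> {a..b}\<rbrakk>
       \<Longrightarrow> \<bar>T x t - T y t\<bar> \<le> k * sup_norm a b (\<lambda>t. x t - y t)"
  shows "\<exists>!x. x \<in> C_space a b \<and> T x = x"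
proof -
  let ?X = "top_of_set {a..b}"
  let ?m = "cfunspace ?X (euclidean_metric :: real metric)"
  have M: "mspace ?m = C_space a b"
    by (subst compactin_mspace_cfunspace) (auto simp: C_space_def compactin_subtopology)
  have d: "mdist ?m x y = sup_norm a b (\<lambda>t. x t - y t)"
    if "x \<in> C_space a b" "y \<in> C_space a b" for x y
  proof -
    have "C_space a b \<subseteq> Met_TC.fspace {a..b}"
      using cfunspace_subset_funspace[of ?X "euclidean_metric :: real metric"] M by simp
    then show ?thesis
      using that \<open>a \<le> b\<close>
      by (auto simp: mdist_cfunspace_eq_mdist_funspace Met_TC.fdist_def sup_norm_def dist_real_def)
  qed
  interpret Metric_space "C_space a b" "mdist ?m"
    using Metric_space_mspace_mdist[of ?m] by (simp only: M)
  have "mcomplete"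
    using Met_TC.mcomplete_cfunspace[of ?X, where 'a = real]
    by (simp only: mcomplete_of_def M Met_TC.Self_def mcomplete_iff_complete complete_UNIV
        flip: euclidean_metric_def)
  moreover have contr: "mdist ?m (T x) (T y) \<le> k * mdist ?m x y"
    if "x \<in> C_space a b" "y \<in> C_space a b" for x y
  proof -
    \<comment> \<open>The sign of k is not assumed; the contraction estimate at the point a shows
      that its right-hand side is nonnegative.\<close>
    have "0 \<le> k * sup_norm a b (\<lambda>t. x t - y t)"
      using order_trans[OF abs_ge_zero con[OF that, of a]] \<open>a \<le> b\<close> by simp
    then show ?thesis
      using con[OF that] by (intro mdist_cfunspace_le) (auto simp: d that dist_real_def)
  qed
  \<comment> \<open>The fixed point theorem needs a nonempty carrier.\<close>
  moreover have "(\<lambda>t\<in>{a..b}. 0) \<in> C_space a b"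
    by (rule restrict_in_C_space) simp
  ultimately obtain x where "x \<in> C_space a b" "T x = x"
    using Banach_fixedpoint_thm[OF _ _ T k] by blast
  moreover have "x = y" if "x \<in> C_space a b" "T x = x" "y \<in> C_space a b" "T y = y" for x y
    using contraction_imp_unique_fixpoint[OF that(2,4) T k contr] that by blast
  ultimately show ?thesis by blast
qed

section \<open>Measurability of continuous data and the normal form of the Green function\<close>

lemma set_borel_measurable_lebesgue_continuous_on:
  fixes f :: "'a::euclidean_space \<Rightarrow> real"
  assumes "A \<in> sets borel" "continuous_on A f"
  shows "set_borel_measurable lebesgue A f"
  using set_measurable_continuous_on[OF assms] unfolding set_borel_measurable_def
  by (intro measurable_completion) simp

text \<open>\<open>green\<close> branches on the order of \<tau> and t, whereas the positive part in
  \<open>unit_green\<close> sees only \<psi> \<tau> and \<psi> t; the last premise matches the two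
  case distinctions.\<close>

lemma green_eq_unit_green:
  assumes "\<psi> a < \<psi> b" "\<psi> a \<le> \<psi> \<tau>" "\<psi> \<tau> \<le> \<psi> b" "\<psi> a \<le> \<psi> t" "\<tau> \<le> t \<longleftrightarrow> \<psi> \<tau> \<le> \<psi> t"
  shows "green a b \<alpha> \<beta> \<psi> \<tau> t
    = (\<psi> b - \<psi> a) powr (\<alpha> + \<beta> - 1) / Gamma (\<alpha> + \<beta>)
      * unit_green \<beta> (\<alpha> + \<beta> - 1) ((\<psi> \<tau> - \<psi> a) / (\<psi> b - \<psi> a)) ((\<psi> t - \<psi> a) / (\<psi> b - \<psi> a))"
proof -
  define L where "L = \<psi> b - \<psi> a"
  have L: "L > 0" using assms by (simp add: L_def)
  have "1 - (\<psi> \<tau> - \<psi> a) / L = (\<psi> b - \<psi> \<tau>) / L"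
    using L by (simp add: field_simps L_def)
  moreover have "max 0 ((\<psi> t - \<psi> a) / L - (\<psi> \<tau> - \<psi> a) / L) = (if \<tau> \<le> t then (\<psi> t - \<psi> \<tau>) / L else 0)"
    using L assms(5) by (auto simp: max_def field_simps)
  \<comment> \<open>Here \<alpha> + \<beta> is arbitrary. If \<open>Gamma\<close> has its default
    value 0 at a pole, division by zero makes both sides 0.\<close>
  ultimately show ?thesis
    using L assms by (cases "Gamma (\<alpha> + \<beta>) = 0")
      (simp_all add: green_def unit_green_def powr_divide field_simps flip: L_def)
qed

text \<open>The integrals require \<tau> -> f \<tau> (x \<tau>) to be measurable. Measurability of f
  in t for each fixed y is therefore a hypothesis; with the Lipschitz condition it makes f a
  Caratheodory function.\<close>

theorem theorem4p9:
  fixes a b \<alpha> \<beta> \<kappa>\<^sub>4 :: real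
    and \<psi> \<psi>' \<kappa>\<^sub>3 :: "real \<Rightarrow> real"
    and f :: "real \<Rightarrow> real \<Rightarrow> real"
    and \<G> :: "(real \<Rightarrow> real) \<Rightarrow> real"
  assumes "a < b"
    and "0 < \<alpha>" "\<alpha> \<le> 1" "0 < \<beta>" "\<beta> \<le> 1" "\<alpha> + \<beta> > 1"
    and "\<forall>t\<in>{a..b}. (\<psi> has_real_derivative \<psi>' t) (at t within {a..b})"
    and "continuous_on {a..b} \<psi>'"
    and "\<forall>t\<in>{a..b}. \<psi>' t > 0"
    and "\<forall>y. set_borel_measurable lebesgue {a<..<b} (\<lambda>t. f t y)"
    and "\<forall>t\<in>{a<..<b}. \<kappa>\<^sub>3 t > 0"
    and "\<forall>t\<in>{a<..<b}. \<forall>x y. \<bar>f t x - f t y\<bar> \<le> \<kappa>\<^sub>3 t * \<bar>x - y\<bar>"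
    and "0 < \<kappa>\<^sub>4" "\<kappa>\<^sub>4 < 1"
    and "\<forall>x\<in>C_space a b. \<forall>y\<in>C_space a b. \<bar>\<G> x - \<G> y\<bar> \<le> \<kappa>\<^sub>4 * sup_norm a b (\<lambda>t. x t - y t)"
    and "set_integrable lebesgue {a<..<b} (\<lambda>t. \<psi>' t * \<kappa>\<^sub>3 t)"
    and "set_integrable lebesgue {a<..<b} (\<lambda>t. \<psi>' t * f t 0)"
    and "\<kappa>\<^sub>4 + G_max a b \<alpha> \<beta> \<psi> * (LINT t:{a<..<b}|lebesgue. \<bar>\<psi>' t * \<kappa>\<^sub>3 t\<bar>) < 1"
  shows "\<exists>!x. mild_solution a b \<alpha> \<beta> \<psi> \<psi>' f \<G> x"
proof -
  note a_b = \<open>a < b\<close> and \<psi>_deriv = assms(7) and \<psi>'_cont = assms(8) and \<psi>'_pos = assms(9)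
    and f_meas = assms(10) and \<kappa>\<^sub>3_pos = assms(11) and f_lip = assms(12)
    and \<G>_lip = assms(15) and \<kappa>\<^sub>3_int = assms(16) and f0_int = assms(17)
    and contr = assms(18)
  define S where "S = {a<..<b}"
  define c where "c = \<alpha> + \<beta> - 1"
  define B where "B = G_max a b \<alpha> \<beta> \<psi>"
  define N where "N = (LINT t:S|lebesgue. \<bar>\<psi>' t * \<kappa>\<^sub>3 t\<bar>)"
  define u where "u t = (\<psi> t - \<psi> a) / (\<psi> b - \<psi> a)" for t
  let ?g = "green a b \<alpha> \<beta> \<psi>"
  have \<beta>: "0 < \<beta>" and c: "0 < c" "c \<le> 1" using assms by (auto simp: c_def)

  \<comment> \<open>Monotonicity of \<psi> and the normalised variable u\<close>
  have \<psi>_cont: "continuous_on {a..b} \<psi>"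
    by (rule DERIV_continuous_on) (use \<psi>_deriv in auto)
  have \<psi>_less: "\<psi> s < \<psi> t" if "a \<le> s" "s < t" "t \<le> b" for s t
  \<comment> \<open>At a and b only one-sided derivatives are given. This criterion asks for
    two-sided ones at interior points only, where they agree with those within [a,b], and for
    continuity up to the ends.\<close>
  proof (rule DERIV_pos_imp_increasing_open[OF \<open>s < t\<close>])
    show "\<exists>y. (\<psi> has_real_derivative y) (at r) \<and> 0 < y" if "s < r" "r < t" for r
      using \<psi>_deriv[rule_format, of r] \<psi>'_pos \<open>a \<le> s\<close> \<open>t \<le> b\<close> that
      by (intro exI[of _ "\<psi>' r"]) (auto simp: at_within_Icc_at)
    show "continuous_on {s..t} \<psi>"
      using \<psi>_cont that by (auto intro: continuous_on_subset)
  qed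
  have \<psi>_le: "\<psi> s \<le> \<psi> t" if "a \<le> s" "s \<le> t" "t \<le> b" for s t
    using \<psi>_less[of s t] that by (cases "s = t") auto
  have \<psi>_a_b: "\<psi> a < \<psi> b" using \<psi>_less a_b by simp
  have u01: "0 \<le> u t" "u t \<le> 1" if "t \<in> {a..b}" for t
    using \<psi>_le[of a t] \<psi>_le[of t b] that \<psi>_a_b by (auto simp: u_def)
  have u_cont: "continuous_on {a..b} u"
    unfolding u_def using \<psi>_a_b by (intro continuous_intros \<psi>_cont) auto

  \<comment> \<open>Bound, continuity and measurability of the Green function\<close>
  have g_eq: "?g \<tau> t = (\<psi> b - \<psi> a) powr c / Gamma (\<alpha> + \<beta>) * unit_green \<beta> c (u \<tau>) (u t)"
    if "\<tau> \<in> {a..b}" "t \<in> {a..b}" for \<tau> t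
  proof -
    have "\<tau> \<le> t \<longleftrightarrow> \<psi> \<tau> \<le> \<psi> t"
      using \<psi>_le[of \<tau> t] \<psi>_less[of t \<tau>] that by (auto simp: not_le[symmetric])
    then show ?thesis
      unfolding u_def c_def using that \<psi>_a_b by (intro green_eq_unit_green \<psi>_le) auto
  qed
  have \<Gamma>: "Gamma (\<alpha> + \<beta>) > 0" using assms by (intro Gamma_real_pos) auto
  have g_bound: "\<bar>?g \<tau> t\<bar> \<le> B" if "\<tau> \<in> {a..b}" "t \<in> {a..b}" for \<tau> t
  proof -
    \<comment> \<open>This identifies the entries of \<open>G_max\<close> with those in
      \<open>abs_unit_green_le\<close>.\<close>
    have c_\<beta>: "c + \<beta> = \<alpha> + 2 * \<beta> - 1" by (simp add: c_def)
    have "B = (\<psi> b - \<psi> a) powr c / Gamma (\<alpha> + \<beta>)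
        * max (\<beta> powr \<beta> * c powr c / (c + \<beta>) powr (c + \<beta>))
              (\<beta> * c powr (c / \<beta>) / (c + \<beta>) powr ((c + \<beta>) / \<beta>))"
      unfolding B_def G_max_def c_\<beta> unfolding c_def by simp
    moreover have "\<bar>?g \<tau> t\<bar> = (\<psi> b - \<psi> a) powr c / Gamma (\<alpha> + \<beta>) * \<bar>unit_green \<beta> c (u \<tau>) (u t)\<bar>"
      using g_eq[OF that] \<Gamma> by (simp add: abs_mult)
    moreover have "\<bar>unit_green \<beta> c (u \<tau>) (u t)\<bar>
        \<le> max (\<beta> powr \<beta> * c powr c / (c + \<beta>) powr (c + \<beta>))
              (\<beta> * c powr (c / \<beta>) / (c + \<beta>) powr ((c + \<beta>) / \<beta>))"
      using u01 that \<beta> c by (intro abs_unit_green_le) auto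
    ultimately show ?thesis
      using \<Gamma> by (simp only:) (intro mult_left_mono, auto)
  qed
  have B: "0 \<le> B" using g_bound[of a a] a_b by auto
  have g_cont: "continuous_on {a..b} (?g \<tau>)" if "\<tau> \<in> {a..b}" for \<tau>
    using u01 u_cont that \<beta> c
    by (intro continuous_on_eq[OF _ g_eq[symmetric]] continuous_on_mult_left
          continuous_on_unit_green continuous_on_const) auto
  have g_meas: "set_borel_measurable lebesgue S (\<lambda>\<tau>. ?g \<tau> t)" if "t \<in> {a..b}" for t
  proof -
    have "continuous_on {a..b} (\<lambda>\<tau>. ?g \<tau> t)"
      using u01 u_cont that \<beta> c
      by (intro continuous_on_eq[OF _ g_eq[symmetric]] continuous_on_mult_left
            continuous_on_unit_green continuous_on_const) auto
    then show ?thesis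
      unfolding S_def
      by (intro set_borel_measurable_lebesgue_continuous_on) (auto intro: continuous_on_subset)
  qed

  \<comment> \<open>Lipschitz estimate and integrability of the nonlinear term\<close>
  define h where "h x \<tau> = \<psi>' \<tau> * f \<tau> (x \<tau>)" for x \<tau>
  have h_diff: "\<bar>h x \<tau> - h y \<tau>\<bar> \<le> \<bar>\<psi>' \<tau> * \<kappa>\<^sub>3 \<tau>\<bar> * \<bar>x \<tau> - y \<tau>\<bar>" if "\<tau> \<in> S" for x y \<tau>
  proof -
    have "\<psi>' \<tau> * \<bar>f \<tau> (x \<tau>) - f \<tau> (y \<tau>)\<bar> \<le> \<psi>' \<tau> * (\<kappa>\<^sub>3 \<tau> * \<bar>x \<tau> - y \<tau>\<bar>)"
      using f_lip \<psi>'_pos that by (intro mult_left_mono) (auto simp: S_def less_imp_le)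
    moreover have "\<psi>' \<tau> > 0" "\<kappa>\<^sub>3 \<tau> > 0" using \<psi>'_pos \<kappa>\<^sub>3_pos that by (auto simp: S_def)
    ultimately show ?thesis
      by (simp add: h_def abs_mult mult.assoc flip: right_diff_distrib)
  qed
  have h_int: "set_integrable lebesgue S (h x)" if "x \<in> C_space a b" for x
  proof -
    have x_cont: "continuous_on {a..b} x" using that by (simp add: C_space_def)
    have "set_borel_measurable lebesgue S (\<lambda>\<tau>. f \<tau> (x \<tau>))"
    proof (rule set_borel_measurable_Caratheodory[where f = f and x = x])
      show "set_borel_measurable lebesgue S (\<lambda>t. f t y)" for y using f_meas by (simp add: S_def)
      show "continuous_on UNIV (f t)" if "t \<in> S" for t
        using f_lip \<kappa>\<^sub>3_pos that
        by (intro lipschitz_on_continuous_on[of "\<kappa>\<^sub>3 t"] lipschitz_onI)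
           (auto simp: S_def dist_real_def less_imp_le)
      show "set_borel_measurable lebesgue S x"
        unfolding S_def using x_cont
        by (intro set_borel_measurable_lebesgue_continuous_on) (auto intro: continuous_on_subset)
    qed
    moreover have "set_borel_measurable lebesgue S \<psi>'"
      unfolding S_def using \<psi>'_cont
      by (intro set_borel_measurable_lebesgue_continuous_on) (auto intro: continuous_on_subset)
    ultimately have meas: "set_borel_measurable lebesgue S (h x)"
      unfolding h_def by (intro set_borel_measurable_mult)
    show ?thesis
    proof (rule set_integrable_bound[OF _ meas])
      \<comment> \<open>Comparing x with the zero function in the Lipschitz estimate gives this
        majorant; its two terms are integrable by the two L1 hypotheses.\<close>
      show "set_integrable lebesgue S (\<lambda>\<tau>. \<bar>h (\<lambda>_. 0) \<tau>\<bar> + \<bar>\<psi>' \<tau> * \<kappa>\<^sub>3 \<tau>\<bar> * sup_norm a b x)"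
        using \<kappa>\<^sub>3_int f0_int unfolding h_def S_def
        by (intro set_integral_add set_integrable_mult_left set_integrable_abs)
      have "norm (h x \<tau>) \<le> norm (\<bar>h (\<lambda>_. 0) \<tau>\<bar> + \<bar>\<psi>' \<tau> * \<kappa>\<^sub>3 \<tau>\<bar> * sup_norm a b x)"
        if "\<tau> \<in> S" for \<tau>
      proof -
        have "\<bar>h x \<tau>\<bar> \<le> \<bar>h (\<lambda>_. 0) \<tau>\<bar> + \<bar>\<psi>' \<tau> * \<kappa>\<^sub>3 \<tau>\<bar> * \<bar>x \<tau>\<bar>"
          using h_diff[OF that, of x "\<lambda>_. 0"] by simp
        also have "\<dots> \<le> \<bar>h (\<lambda>_. 0) \<tau>\<bar> + \<bar>\<psi>' \<tau> * \<kappa>\<^sub>3 \<tau>\<bar> * sup_norm a b x"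
          using abs_le_sup_norm[OF x_cont, of \<tau>] that
          by (intro add_left_mono mult_left_mono) (auto simp: S_def)
        finally show ?thesis by simp
      qed
      then show "AE \<tau> in lebesgue. \<tau> \<in> S \<longrightarrow>
          norm (h x \<tau>) \<le> norm (\<bar>h (\<lambda>_. 0) \<tau>\<bar> + \<bar>\<psi>' \<tau> * \<kappa>\<^sub>3 \<tau>\<bar> * sup_norm a b x)"
        by simp
    qed
  qed
  have S_sub: "S \<subseteq> {a..b}" by (auto simp: S_def)
  have gh_int: "set_integrable lebesgue S (\<lambda>\<tau>. ?g \<tau> t * h x \<tau>)"
    if "x \<in> C_space a b" "t \<in> {a..b}" for x t
    using S_sub that(2)
    by (intro set_integrable_bounded_mult[where B = B, OF h_int[OF that(1)] g_meas[OF that(2)]] g_bound) auto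

  \<comment> \<open>The integral operator and its contraction constant\<close>
  define T where "T x = (\<lambda>t\<in>{a..b}. u t powr \<beta> * \<G> x + (LINT \<tau>:S|lebesgue. ?g \<tau> t * h x \<tau>))" for x
  have T: "T \<in> C_space a b \<rightarrow> C_space a b"
  proof
    fix x assume x: "x \<in> C_space a b"
    have "continuous_on {a..b} (\<lambda>t. LINT \<tau>:S|lebesgue. ?g \<tau> t * h x \<tau>)"
      using S_sub
      by (intro continuous_on_set_integral_kernel[where k = ?g and B = B, OF h_int[OF x]] g_meas g_bound g_cont) auto
    then have "continuous_on {a..b} (\<lambda>t. u t powr \<beta> * \<G> x + (LINT \<tau>:S|lebesgue. ?g \<tau> t * h x \<tau>))"
      using u01 \<beta> by (intro continuous_intros continuous_on_powr' u_cont) auto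
    then show "T x \<in> C_space a b"
      unfolding T_def by (rule restrict_in_C_space)
  qed
  have T_diff: "\<bar>T x t - T y t\<bar> \<le> (\<kappa>\<^sub>4 + B * N) * sup_norm a b (\<lambda>t. x t - y t)"
    if x: "x \<in> C_space a b" and y: "y \<in> C_space a b" and t: "t \<in> {a..b}" for x y t
  proof -
    define d where "d = sup_norm a b (\<lambda>t. x t - y t)"
    have d: "\<bar>x \<tau> - y \<tau>\<bar> \<le> d" if "\<tau> \<in> {a..b}" for \<tau>
      unfolding d_def using x y that
      by (intro abs_le_sup_norm[of a b "\<lambda>t. x t - y t"] continuous_intros) (auto simp: C_space_def)
    have "T x t - T y t = u t powr \<beta> * (\<G> x - \<G> y)
        + (LINT \<tau>:S|lebesgue. ?g \<tau> t * h x \<tau> - ?g \<tau> t * h y \<tau>)"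
      \<comment> \<open>The boundary term will contribute \<open>\<kappa>\<^sub>4\<close>, as
        u^\<beta> <= 1, and the integral will contribute \<open>B * N\<close>.\<close>
      using t set_integral_diff(2)[OF gh_int[OF x t] gh_int[OF y t]]
      by (simp add: T_def right_diff_distrib)
    moreover have "\<bar>u t powr \<beta> * (\<G> x - \<G> y)\<bar> \<le> \<kappa>\<^sub>4 * d"
    proof -
      have "u t powr \<beta> * \<bar>\<G> x - \<G> y\<bar> \<le> 1 * \<bar>\<G> x - \<G> y\<bar>"
        using u01[OF t] \<beta> by (intro mult_right_mono) (auto simp: powr_le1)
      moreover have "\<bar>\<G> x - \<G> y\<bar> \<le> \<kappa>\<^sub>4 * d"
        using \<G>_lip x y by (simp add: d_def)
      ultimately show ?thesis by (simp add: abs_mult)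
    qed
    moreover have "\<bar>LINT \<tau>:S|lebesgue. ?g \<tau> t * h x \<tau> - ?g \<tau> t * h y \<tau>\<bar> \<le> B * N * d"
    proof -
      have int: "set_integrable lebesgue S (\<lambda>\<tau>. ?g \<tau> t * h x \<tau> - ?g \<tau> t * h y \<tau>)"
        by (rule set_integral_diff(1)[OF gh_int[OF x t] gh_int[OF y t]])
      have "\<bar>LINT \<tau>:S|lebesgue. ?g \<tau> t * h x \<tau> - ?g \<tau> t * h y \<tau>\<bar>
          \<le> (LINT \<tau>:S|lebesgue. \<bar>?g \<tau> t * h x \<tau> - ?g \<tau> t * h y \<tau>\<bar>)"
        using set_integral_norm_bound[OF int] by simp
      also have "\<dots> \<le> (LINT \<tau>:S|lebesgue. B * d * \<bar>\<psi>' \<tau> * \<kappa>\<^sub>3 \<tau>\<bar>)"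
      proof (rule set_integral_mono)
        show "set_integrable lebesgue S (\<lambda>\<tau>. \<bar>?g \<tau> t * h x \<tau> - ?g \<tau> t * h y \<tau>\<bar>)"
          by (rule set_integrable_abs[OF int])
        show "set_integrable lebesgue S (\<lambda>\<tau>. B * d * \<bar>\<psi>' \<tau> * \<kappa>\<^sub>3 \<tau>\<bar>)"
          using \<kappa>\<^sub>3_int unfolding S_def by (intro set_integrable_mult_right set_integrable_abs)
        fix \<tau> assume \<tau>: "\<tau> \<in> S"
        have "\<bar>?g \<tau> t * h x \<tau> - ?g \<tau> t * h y \<tau>\<bar> = \<bar>?g \<tau> t\<bar> * \<bar>h x \<tau> - h y \<tau>\<bar>"
          by (simp add: abs_mult flip: right_diff_distrib)
        also have "\<dots> \<le> B * (\<bar>\<psi>' \<tau> * \<kappa>\<^sub>3 \<tau>\<bar> * \<bar>x \<tau> - y \<tau>\<bar>)"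
          using \<tau> S_sub t B by (intro mult_mono g_bound h_diff) auto
        also have "\<dots> \<le> B * (\<bar>\<psi>' \<tau> * \<kappa>\<^sub>3 \<tau>\<bar> * d)"
          using \<tau> S_sub B by (intro mult_left_mono d) auto
        finally show "\<bar>?g \<tau> t * h x \<tau> - ?g \<tau> t * h y \<tau>\<bar> \<le> B * d * \<bar>\<psi>' \<tau> * \<kappa>\<^sub>3 \<tau>\<bar>"
          by (simp add: mult_ac)
      qed
      also have "\<dots> = B * N * d" by (simp add: N_def)
      finally show ?thesis .
    qed
    ultimately show ?thesis by (simp add: distrib_right flip: d_def)
  qed

  \<comment> \<open>Fixed points are the mild solutions\<close>
  have "\<exists>!x. x \<in> C_space a b \<and> T x = x"
    using contr T T_diff a_b
    by (intro C_space_contraction[where k = "\<kappa>\<^sub>4 + B * N"]) (auto simp: B_def N_def S_def)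
  \<comment> \<open>For x in C[a,b] the integrability conjunct holds by \<open>gh_int\<close>.
    Outside [a,b] both T x and x are \<open>undefined\<close>, so equality of functions is the
    integral equation on [a,b].\<close>
  moreover have "mild_solution a b \<alpha> \<beta> \<psi> \<psi>' f \<G> x \<longleftrightarrow> x \<in> C_space a b \<and> T x = x" for x
  proof (cases "x \<in> C_space a b")
    case True
    then have "x \<in> extensional {a..b}" by (simp add: C_space_def)
    then have "T x = x \<longleftrightarrow> (\<forall>t\<in>{a..b}. x t = u t powr \<beta> * \<G> x + (LINT \<tau>:S|lebesgue. ?g \<tau> t * h x \<tau>))"
      unfolding T_def by (auto simp: fun_eq_iff restrict_def extensional_def)
    then show ?thesis
      using True gh_int[OF True] by (simp add: mild_solution_def h_def u_def S_def mult.assoc)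
  qed (simp add: mild_solution_def)
  ultimately show ?thesis by simp
qed

end
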